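(* Let $X$ be a real Banach space with the unconditional compact approximation property (UKAP). Then every strongly extreme point of the closed unit ball $B_X$ is a denting point of $B_X$. In particular, this holds if $X$ has an unconditional basis with unconditional basis constant $1$.
   Context: A Banach space $X$ has the unconditional compact approximation property (UKAP) if there exists a sequence $(T_n)$ of linear compact operators on $X$ such that $\lim_n\|T_nx-x\|=0$ for every $x\in X$ and $\lim_n\|I-2T_n\|=1$. The unconditional basis constant of an unconditional basis $(e_k)$ is the supremum, over all choices of signs $\theta_k=\pm1$, of the norms of the operators $\sum_k a_ke_k\mapsto\sum_k\theta_ka_ke_k$. A point $x\in B_X$ is a strongly extreme point of $B_X$ if for any sequences $(y_n),(z_n)$ in $B_X$, $\lim_n\|x-\frac{y_n+z_n}{2}\|=0$ implies $\lim_n\|y_n-z_n\|=0$. A slice of $B_X$ is a set $S(B_X,x^*,\delta)=\{y\in B_X:x^*(y)>\sup_{z\in B_X}x^*(z)-\delta\}$ with $\delta>0$, $0\ne x^*\in X^*$. The point $x$ is a denting point of $B_X$ if for every $\varepsilon>0$ and $\delta>0$ there is a slice $S(B_X,x^*,\delta)$ which contains $x$ and has diameter less than $\varepsilon$. *)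

theory Defs
  imports "HOL-Analysis.Analysis"
begin

definition compact_operator :: "('a::real_normed_vector \<Rightarrow> 'b::real_normed_vector) \<Rightarrow> bool" where
  "compact_operator T \<longleftrightarrow> linear T \<and> compact (closure (T ` cball 0 1))"

definition UKAP :: "'a::banach itself \<Rightarrow> bool" where
  "UKAP _ \<longleftrightarrow> (\<exists>T :: nat \<Rightarrow> 'a \<Rightarrow> 'a.
     (\<forall>n. compact_operator (T n)) \<and>
     (\<forall>x. (\<lambda>n. norm (T n x - x)) \<longlonglongrightarrow> 0) \<and>
     (\<lambda>n. onorm (\<lambda>x. x - 2 *\<^sub>R T n x)) \<longlonglongrightarrow> 1)"

text \<open>
  A basis is a finite or infinite sequence, of length \<open>N\<close>: the basis vectors are the \<open>e k\<close>
  with \<open>k < N\<close>, and the values of \<open>e\<close> beyond \<open>N\<close> are irrelevant, since the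
  coefficients there are required to be zero.
\<close>

definition basis_expansion ::
    "enat \<Rightarrow> (nat \<Rightarrow> 'a::banach) \<Rightarrow> (nat \<Rightarrow> real) \<Rightarrow> 'a \<Rightarrow> bool" where
  "basis_expansion N e a x \<longleftrightarrow>
     (\<forall>k. \<not> enat k < N \<longrightarrow> a k = 0) \<and> (\<lambda>k. a k *\<^sub>R e k) sums x"

definition schauder_basis :: "enat \<Rightarrow> (nat \<Rightarrow> 'a::banach) \<Rightarrow> bool" where
  "schauder_basis N e \<longleftrightarrow> (\<forall>x. \<exists>!a. basis_expansion N e a x)"

definition unconditional_basis :: "enat \<Rightarrow> (nat \<Rightarrow> 'a::banach) \<Rightarrow> bool" where
  "unconditional_basis N e \<longleftrightarrow> schauder_basis N e \<and>
     (\<forall>x a. basis_expansion N e a x \<longrightarrow>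
        (\<forall>p. bij p \<longrightarrow> summable (\<lambda>k. a (p k) *\<^sub>R e (p k))))"

definition basis_coeff :: "enat \<Rightarrow> (nat \<Rightarrow> 'a::banach) \<Rightarrow> 'a \<Rightarrow> nat \<Rightarrow> real" where
  "basis_coeff N e x = (THE a. basis_expansion N e a x)"

definition sign_operator ::
    "enat \<Rightarrow> (nat \<Rightarrow> 'a::banach) \<Rightarrow> (nat \<Rightarrow> real) \<Rightarrow> 'a \<Rightarrow> 'a" where
  "sign_operator N e \<theta> x = (\<Sum>k. (\<theta> k * basis_coeff N e x k) *\<^sub>R e k)"

text \<open>
  The inner supremum is the operator norm (as in \<open>onorm\<close>), taken in the extended
  reals so that neither supremum can be an unspecified value.
\<close>

definition unconditional_basis_constant :: "enat \<Rightarrow> (nat \<Rightarrow> 'a::banach) \<Rightarrow> ereal" where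
  "unconditional_basis_constant N e =
     (SUP \<theta> \<in> {\<theta>. \<forall>k. \<theta> k = 1 \<or> \<theta> k = - 1}.
        SUP x. ereal (norm (sign_operator N e \<theta> x) / norm x))"

definition strongly_extreme_point :: "'a::real_normed_vector \<Rightarrow> bool" where
  "strongly_extreme_point x \<longleftrightarrow> x \<in> cball 0 1 \<and>
     (\<forall>y z. (\<forall>n. y n \<in> cball 0 1) \<longrightarrow> (\<forall>n. z n \<in> cball 0 1) \<longrightarrow>
        (\<lambda>n::nat. norm (x - (y n + z n) /\<^sub>R 2)) \<longlonglongrightarrow> 0 \<longrightarrow>
        (\<lambda>n. norm (y n - z n)) \<longlonglongrightarrow> 0)"

definition ball_slice :: "('a::real_normed_vector \<Rightarrow>\<^sub>L real) \<Rightarrow> real \<Rightarrow> 'a set" where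
  "ball_slice f \<delta> =
     {y \<in> cball 0 1. blinfun_apply f y > (SUP z \<in> cball 0 1. blinfun_apply f z) - \<delta>}"

definition denting_point :: "'a::real_normed_vector \<Rightarrow> bool" where
  "denting_point x \<longleftrightarrow> x \<in> cball 0 1 \<and>
     (\<forall>\<epsilon>>0. \<forall>\<delta>>0. \<exists>f. f \<noteq> 0 \<and> x \<in> ball_slice f \<delta> \<and> diameter (ball_slice f \<delta>) < \<epsilon>)"

end

theory Submission
  imports Defs
begin

text \<open>
  Let \<open>T\<^sub>n\<close> be the operators given by the approximation property, and let \<open>x\<close> be strongly
  extreme. Compactness of \<open>T\<^sub>n\<close> and strong extremality of \<open>x\<close> combine as follows.

  If \<open>y\<close> is in the unit ball and \<open>T\<^sub>n y\<close> is close to \<open>x\<close>, then \<open>T\<^sub>n y\<close>, and with it \<open>x\<close>, is nearly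
  the midpoint of \<open>y\<close> and \<open>2 T\<^sub>n y - y\<close>. The second point has norm at most \<open>\<parallel>I - 2 T\<^sub>n\<parallel>\<close>, which is
  nearly \<open>1\<close>, so strong extremality forces these two points together and hence \<open>y\<close> towards \<open>x\<close>
  (\<open>strongly_extreme_localized\<close>). Therefore the points \<open>y\<close> of the ball with
  \<open>\<parallel>y - x\<parallel> \<ge> \<epsilon>\<close> have \<open>T\<^sub>n y\<close> bounded away from \<open>x\<close>, for one suitable \<open>n\<close>.

  Since \<open>T\<^sub>n\<close> is compact, these points lie in finitely many convex pieces of the ball, the
  preimages of small balls that stay away from \<open>T\<^sub>n x\<close>. A strongly extreme point at positive
  distance from each of finitely many convex subsets of the ball is at positive distance from the
  convex hull of their union: a segment in the ball that passes near \<open>x\<close> has an end near \<open>x\<close>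
  (\<open>strongly_extreme_away_Union\<close>). So \<open>x\<close> is at positive distance from the convex hull of
  \<open>{y. \<parallel>y\<parallel> \<le> 1 \<and> \<parallel>y - x\<parallel> \<ge> \<epsilon>}\<close>, and a separating functional gives a slice that contains \<open>x\<close> and
  has diameter at most \<open>2\<epsilon>\<close>.

  For an unconditional basis with constant \<open>1\<close>, the partial sum projections \<open>P\<^sub>n\<close> serve as \<open>T\<^sub>n\<close>,
  because \<open>I - 2 P\<^sub>n\<close> only flips the signs of the first \<open>n\<close> coefficients.
\<close>

section \<open>Sublinear functionals and separation\<close>

text \<open>
  Homogeneity is required only as an inequality for positive factors, which is what infima inherit;
  applied to \<open>t\<close> and \<open>1 / t\<close> it implies equality.
\<close>

definition sublinear :: "('a::real_vector \<Rightarrow> real) \<Rightarrow> bool" where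
  "sublinear p \<longleftrightarrow> (\<forall>x y. p (x + y) \<le> p x + p y) \<and> (\<forall>t>0. \<forall>x. p (t *\<^sub>R x) \<le> t * p x)"

lemma sublinear_add: "sublinear p \<Longrightarrow> p (x + y) \<le> p x + p y"
  by (simp add: sublinear_def)

lemma sublinear_zero:
  assumes "sublinear p"
  shows "p 0 = 0"
proof -
  have "p (0 + 0) \<le> p 0 + p 0" by (rule sublinear_add[OF assms])
  moreover have "p ((1/2) *\<^sub>R 0) \<le> (1/2) * p 0"
    using assms unfolding sublinear_def by (meson half_gt_zero zero_less_one)
  ultimately show ?thesis by simp
qed

lemma sublinear_scale:
  assumes "sublinear p" "t \<ge> 0"
  shows "p (t *\<^sub>R x) = t * p x"
proof (cases "t = 0")
  case True
  then show ?thesis by (simp add: sublinear_zero[OF assms(1)])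
next
  case False
  with assms have t: "t > 0" by simp
  then have "p (inverse t *\<^sub>R (t *\<^sub>R x)) \<le> inverse t * p (t *\<^sub>R x)"
    using assms(1) unfolding sublinear_def by (metis inverse_positive_iff_positive)
  then have "t * p x \<le> p (t *\<^sub>R x)"
    using t by (simp add: field_simps)
  moreover have "p (t *\<^sub>R x) \<le> t * p x"
    using assms(1) t unfolding sublinear_def by blast
  ultimately show ?thesis by simp
qed

lemma sublinear_lower: "sublinear p \<Longrightarrow> - p (- x) \<le> p x"
  using sublinear_add[of p x "- x"] sublinear_zero[of p] by simp

text \<open>Three infima are formed below: over a chain of functionals, over a ray, and over a cone. In each
  case the index that serves for a sum, or for a multiple, is itself built from the given indices,
  which is why the hypotheses allow a new index \<open>k\<close>.\<close>

lemma sublinear_INF: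
  assumes "I \<noteq> {}"
    and bdd: "\<And>x. bdd_below ((\<lambda>i. F i x) ` I)"
    and add: "\<And>i j x y. i \<in> I \<Longrightarrow> j \<in> I \<Longrightarrow> \<exists>k\<in>I. F k (x + y) \<le> F i x + F j y"
    and scale: "\<And>i t x. i \<in> I \<Longrightarrow> t > 0 \<Longrightarrow> \<exists>k\<in>I. F k (t *\<^sub>R x) \<le> t * F i x"
  shows "sublinear (\<lambda>x. INF i\<in>I. F i x)"
  unfolding sublinear_def
proof (intro conjI allI impI)
  fix x y
  have *: "(INF i\<in>I. F i (x + y)) \<le> F i x + F j y" if "i \<in> I" "j \<in> I" for i j
    using add[OF that, of x y] cINF_lower[OF bdd] by (meson order_trans)
  have "(INF i\<in>I. F i (x + y)) - F j y \<le> (INF i\<in>I. F i x)" if "j \<in> I" for j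
    using *[OF _ that] \<open>I \<noteq> {}\<close> by (intro cINF_greatest) (auto simp: algebra_simps)
  then have "(INF i\<in>I. F i (x + y)) - (INF i\<in>I. F i x) \<le> (INF j\<in>I. F j y)"
    using \<open>I \<noteq> {}\<close> by (intro cINF_greatest) (auto simp: algebra_simps)
  then show "(INF i\<in>I. F i (x + y)) \<le> (INF i\<in>I. F i x) + (INF i\<in>I. F i y)" by simp
next
  fix t :: real and x
  assume t: "t > 0"
  have "(INF i\<in>I. F i (t *\<^sub>R x)) \<le> t * F i x" if "i \<in> I" for i
    using scale[OF that t, of x] cINF_lower[OF bdd] by (meson order_trans)
  then have "(INF i\<in>I. F i (t *\<^sub>R x)) / t \<le> (INF i\<in>I. F i x)"
    using \<open>I \<noteq> {}\<close> t by (intro cINF_greatest) (auto simp: field_simps)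
  then show "(INF i\<in>I. F i (t *\<^sub>R x)) \<le> t * (INF i\<in>I. F i x)"
    using t by (simp add: field_simps)
qed

text \<open>For fixed \<open>y\<close>, the infimum over \<open>t \<ge> 0\<close> of \<open>q (x + t y) - t q y\<close> is sublinear in \<open>x\<close> and lies below
  \<open>q\<close>, so by minimality it equals \<open>q\<close>. The member \<open>t = 1\<close> of the family then gives
  \<open>q x + q y \<le> q (x + y)\<close>, the reverse of subadditivity.\<close>

lemma minimal_sublinear_linear:
  fixes q :: "'a::real_vector \<Rightarrow> real"
  assumes q: "sublinear q"
    and min: "\<And>q'. sublinear q' \<Longrightarrow> (\<And>x. q' x \<le> q x) \<Longrightarrow> q' = q"
  shows "linear q"
proof -
  have add: "q (x + y) = q x + q y" for x y
  proof -
    define F where "F t x = q (x + t *\<^sub>R y) - t * q y" for t :: real and x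
    have bdd: "bdd_below ((\<lambda>t. F t x) ` {0..})" for x
    proof (rule bdd_belowI2)
      fix t :: real assume "t \<in> {0..}"
      then have "t * q y = q (t *\<^sub>R y)" by (simp add: sublinear_scale[OF q])
      also have "\<dots> \<le> q (x + t *\<^sub>R y) + q (- x)"
        using sublinear_add[OF q, of "x + t *\<^sub>R y" "- x"] by simp
      finally show "- q (- x) \<le> F t x" by (simp add: F_def)
    qed
    have "sublinear (\<lambda>x. INF t\<in>{0..}. F t x)"
    proof (rule sublinear_INF[OF _ bdd])
      fix s t :: real and x z :: 'a assume st: "s \<in> {0..}" "t \<in> {0..}"
      have "q ((x + z) + (s + t) *\<^sub>R y) \<le> q (x + s *\<^sub>R y) + q (z + t *\<^sub>R y)"
        using sublinear_add[OF q, of "x + s *\<^sub>R y" "z + t *\<^sub>R y"] by (simp add: algebra_simps)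
      then have "F (s + t) (x + z) \<le> F s x + F t z" by (simp add: F_def algebra_simps)
      then show "\<exists>k\<in>{0..}. F k (x + z) \<le> F s x + F t z" using st by force
    next
      fix s t :: real and x :: 'a assume st: "s \<in> {0..}" "t > 0"
      have "q (t *\<^sub>R x + (t * s) *\<^sub>R y) = t * q (x + s *\<^sub>R y)"
        using sublinear_scale[OF q, of t "x + s *\<^sub>R y"] st by (simp add: algebra_simps)
      then have "F (t * s) (t *\<^sub>R x) \<le> t * F s x" by (simp add: F_def algebra_simps)
      then show "\<exists>k\<in>{0..}. F k (t *\<^sub>R x) \<le> t * F s x" using st by force
    qed simp
    moreover have "(INF t\<in>{0..}. F t x) \<le> q x" for x
      using cINF_lower[OF bdd, of 0 x] by (simp add: F_def)
    ultimately have "(\<lambda>x. INF t\<in>{0..}. F t x) = q" by (rule min)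
    then have "q x \<le> F 1 x"
      using cINF_lower[OF bdd, of 1 x] by (metis atLeast_iff zero_le_one)
    then show ?thesis using sublinear_add[OF q, of x y] by (simp add: F_def)
  qed
  have neg: "q (- x) = - q x" for x
    using add[of x "- x"] sublinear_zero[OF q] by simp
  show ?thesis
  proof (rule linearI)
    fix c :: real and x
    show "q (c *\<^sub>R x) = c *\<^sub>R q x"
      using sublinear_scale[OF q, of "\<bar>c\<bar>" x] neg[of "\<bar>c\<bar> *\<^sub>R x"]
      by (cases "c \<ge> 0") auto
  qed (rule add)
qed

text \<open>This is the Hahn-Banach theorem in the form with trivial subspace: Zorn's lemma gives a minimal
  sublinear functional below \<open>p\<close>. A chain has a lower bound because every sublinear \<open>q \<le> p\<close>
  satisfies \<open>q x \<ge> - q (- x) \<ge> - p (- x)\<close>.\<close>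

lemma sublinear_dominates_linear:
  fixes p :: "'a::real_vector \<Rightarrow> real"
  assumes p: "sublinear p"
  shows "\<exists>f. linear f \<and> (\<forall>x. f x \<le> p x)"
proof -
  define A where "A = {q. sublinear q \<and> q \<le> p}"
  have "\<exists>m\<in>A. \<forall>a\<in>A. a \<le> m \<longrightarrow> a = m"
  proof (rule predicate_Zorn)
    show "partial_order_on A (relation_of (\<lambda>a b. b \<le> a) A)"
      by (rule partial_order_on_relation_ofI) auto
  next
    fix C assume C: "C \<in> Chains (relation_of (\<lambda>a b. b \<le> a) A)"
    then have CA: "C \<subseteq> A" and tot: "\<And>a b. a \<in> C \<Longrightarrow> b \<in> C \<Longrightarrow> a \<le> b \<or> b \<le> a"
      by (auto simp: Chains_def relation_of_def)
    show "\<exists>u\<in>A. \<forall>a\<in>C. u \<le> a"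
    proof (cases "C = {}")
      case True
      then show ?thesis using p by (auto simp: A_def)
    next
      case False
      have bdd: "bdd_below ((\<lambda>q. q x) ` C)" for x
      proof (rule bdd_belowI2)
        fix q assume "q \<in> C"
        then have "sublinear q" "q (- x) \<le> p (- x)" using CA by (auto simp: A_def le_fun_def)
        then show "- p (- x) \<le> q x" using sublinear_lower[of q x] by simp
      qed
      have "sublinear (\<lambda>x. INF q\<in>C. q x)"
      proof (rule sublinear_INF[OF False bdd])
        fix q r x y assume qr: "q \<in> C" "r \<in> C"
        from tot[OF qr] show "\<exists>k\<in>C. k (x + y) \<le> q x + r y"
        proof
          assume "q \<le> r"
          then have "q (x + y) \<le> q x + r y"
            using sublinear_add[of q x y] qr CA by (force simp: A_def le_fun_def dest: spec[of _ y])
          then show ?thesis using qr by blast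
        next
          assume "r \<le> q"
          then have "r (x + y) \<le> q x + r y"
            using sublinear_add[of r x y] qr CA by (force simp: A_def le_fun_def dest: spec[of _ x])
          then show ?thesis using qr by blast
        qed
      next
        fix q and t :: real and x assume "q \<in> C" "t > 0"
        then show "\<exists>k\<in>C. k (t *\<^sub>R x) \<le> t * q x"
          using CA by (auto simp: A_def sublinear_def)
      qed
      moreover have low: "(\<lambda>x. INF q\<in>C. q x) \<le> q" if "q \<in> C" for q
        using cINF_lower[OF bdd that] by (simp add: le_fun_def)
      moreover have "(\<lambda>x. INF q\<in>C. q x) \<le> p"
      proof -
        obtain q where "q \<in> C" using False by blast
        then show ?thesis using low[of q] CA by (auto simp: A_def intro: order_trans)
      qed
      ultimately show ?thesis by (auto simp: A_def)
    qed
  qed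
  then obtain m where m: "sublinear m" "m \<le> p" and min: "\<And>a. a \<in> A \<Longrightarrow> a \<le> m \<Longrightarrow> a = m"
    by (auto simp: A_def)
  have "linear m"
  proof (rule minimal_sublinear_linear[OF m(1)])
    fix q' assume "sublinear q'" and le: "\<And>x. q' x \<le> m x"
    moreover have "q' \<le> m" using le by (simp add: le_fun_def)
    ultimately show "q' = m" using m(2) by (intro min) (auto simp: A_def)
  qed
  then show ?thesis using m(2) by (auto simp: le_fun_def)
qed

text \<open>The common denominator \<open>s + t\<close> may vanish, so the combination is stated without division.\<close>

lemma convex_cone_add:
  fixes a b :: "'a::real_vector"
  assumes "convex A" "a \<in> A" "b \<in> A" "s \<ge> 0" "t \<ge> 0"
  shows "\<exists>c\<in>A. s *\<^sub>R a + t *\<^sub>R b = (s + t) *\<^sub>R c"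
proof (cases "s + t = 0")
  case True
  then have "s = 0" "t = 0" using assms by auto
  then show ?thesis using assms by auto
next
  case False
  define c where "c = (s / (s + t)) *\<^sub>R a + (t / (s + t)) *\<^sub>R b"
  have "c \<in> A" unfolding c_def
    using assms False by (intro convexD) (auto simp: add_divide_distrib[symmetric])
  moreover have "s *\<^sub>R a + t *\<^sub>R b = (s + t) *\<^sub>R c"
    using False by (simp add: c_def scaleR_right_distrib)
  ultimately show ?thesis by blast
qed

text \<open>The sublinear functional \<open>p v = inf {\<parallel>v + t a\<parallel> - t r | t \<ge> 0, a \<in> A}\<close> is finite because \<open>r \<le> \<parallel>a\<parallel>\<close> on
  \<open>A\<close>, and subadditive because \<open>A\<close> is convex. It is chosen so that \<open>p v \<le> \<parallel>v\<parallel>\<close> (take \<open>t = 0\<close>) and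
  \<open>p (- a) \<le> - r\<close> (take \<open>t = 1\<close>): every linear functional below \<open>p\<close> is bounded and at least \<open>r\<close>
  on \<open>A\<close>.\<close>

lemma separating_functional:
  fixes A :: "'a::real_normed_vector set"
  assumes "convex A" and far: "\<And>a. a \<in> A \<Longrightarrow> r \<le> norm a"
  shows "\<exists>f :: 'a \<Rightarrow>\<^sub>L real. \<forall>a\<in>A. r \<le> f a"
proof (cases "A = {}")
  case False
  \<comment> \<open>the infimum of \<open>F i v\<close> over \<open>i \<in> I\<close> is the functional \<open>p v\<close>\<close>
  define F :: "real \<times> 'a \<Rightarrow> 'a \<Rightarrow> real" where "F = (\<lambda>(t, a) v. norm (v + t *\<^sub>R a) - t * r)"
  define I where "I = {0::real..} \<times> A"
  have bdd: "bdd_below ((\<lambda>i. F i v) ` I)" for v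
  proof (rule bdd_belowI2)
    fix i assume "i \<in> I"
    then obtain t a where i: "i = (t, a)" "t \<ge> 0" "a \<in> A" by (auto simp: I_def)
    have "t * r \<le> t * norm a" using i far by (intro mult_left_mono) auto
    moreover have "norm (t *\<^sub>R a) \<le> norm (v + t *\<^sub>R a) + norm v"
      using norm_triangle_ineq4[of "v + t *\<^sub>R a" v] by simp
    ultimately show "- norm v \<le> F i v" using i by (simp add: F_def)
  qed
  have "sublinear (\<lambda>v. INF i\<in>I. F i v)"
  proof (rule sublinear_INF[OF _ bdd])
    show "I \<noteq> {}" using False by (simp add: I_def)
  next
    fix i j v w assume "i \<in> I" "j \<in> I"
    then obtain s a t b where ij: "i = (s, a)" "j = (t, b)" "s \<ge> 0" "t \<ge> 0" "a \<in> A" "b \<in> A"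
      by (auto simp: I_def)
    obtain c where c: "c \<in> A" "s *\<^sub>R a + t *\<^sub>R b = (s + t) *\<^sub>R c"
      using convex_cone_add[OF \<open>convex A\<close>] ij by meson
    have "norm ((v + w) + (s + t) *\<^sub>R c) \<le> norm (v + s *\<^sub>R a) + norm (w + t *\<^sub>R b)"
      using norm_triangle_ineq[of "v + s *\<^sub>R a" "w + t *\<^sub>R b"] c(2)
      by (metis add.assoc add.left_commute)
    then have "F (s + t, c) (v + w) \<le> F i v + F j w"
      using ij by (simp add: F_def algebra_simps)
    then show "\<exists>k\<in>I. F k (v + w) \<le> F i v + F j w"
      using ij c by (intro bexI[of _ "(s + t, c)"]) (auto simp: I_def)
  next
    fix i and t :: real and v assume "i \<in> I" and t: "t > 0"
    then obtain s a where i: "i = (s, a)" "s \<ge> 0" "a \<in> A" by (auto simp: I_def)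
    have "t *\<^sub>R v + (t * s) *\<^sub>R a = t *\<^sub>R (v + s *\<^sub>R a)" by (simp add: algebra_simps)
    then have "norm (t *\<^sub>R v + (t * s) *\<^sub>R a) = t * norm (v + s *\<^sub>R a)" using t by simp
    then have "F (t * s, a) (t *\<^sub>R v) = t * F i v"
      using i by (simp add: F_def right_diff_distrib)
    then show "\<exists>k\<in>I. F k (t *\<^sub>R v) \<le> t * F i v"
      using i t by (intro bexI[of _ "(t * s, a)"]) (auto simp: I_def)
  qed
  then obtain f where f: "linear f" "\<And>v. f v \<le> (INF i\<in>I. F i v)"
    using sublinear_dominates_linear by blast
  have le: "f v \<le> norm (v + t *\<^sub>R a) - t * r" if "t \<ge> 0" "a \<in> A" for v t a
    using f(2)[of v] cINF_lower[OF bdd[of v], of "(t, a)"] that by (simp add: F_def I_def)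
  obtain a0 where "a0 \<in> A" using False by blast
  have up: "f v \<le> norm v" for v using le[of 0 a0 v] \<open>a0 \<in> A\<close> by simp
  have "bounded_linear f"
  proof (intro bounded_linear.intro f(1) bounded_linear_axioms.intro exI allI)
    fix v show "norm (f v) \<le> norm v * 1"
      using up[of v] up[of "- v"] linear_neg[OF f(1), of v] by simp
  qed
  moreover have "r \<le> f a" if "a \<in> A" for a
    using le[of 1 a "- a"] that linear_neg[OF f(1), of a] by simp
  ultimately show ?thesis by (intro exI[of _ "Blinfun f"]) (simp add: bounded_linear_Blinfun_apply)
qed simp

section \<open>Convex hulls near a strongly extreme point\<close>

lemma strongly_extreme_modulus:
  assumes "strongly_extreme_point x" "\<epsilon> > 0"
  obtains \<delta> where "\<delta> > 0"
    "\<And>y z. norm y \<le> 1 \<Longrightarrow> norm z \<le> 1 \<Longrightarrow> norm (x - (y + z) /\<^sub>R 2) < \<delta> \<Longrightarrow> norm (y - z) < \<epsilon>"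
proof (rule ccontr)
  note * = that
  assume "\<not> thesis"
  then have "\<exists>y z. norm y \<le> 1 \<and> norm z \<le> 1 \<and> norm (x - (y + z) /\<^sub>R 2) < \<delta> \<and> \<not> norm (y - z) < \<epsilon>"
    if "\<delta> > 0" for \<delta> using that *[of \<delta>] by meson
  then have "\<forall>n::nat. \<exists>y z. norm y \<le> 1 \<and> norm z \<le> 1 \<and>
      norm (x - (y + z) /\<^sub>R 2) < inverse (real (Suc n)) \<and> \<not> norm (y - z) < \<epsilon>"
    by simp
  then obtain y z where yz: "\<And>n::nat. norm (y n) \<le> 1" "\<And>n. norm (z n) \<le> 1"
      "\<And>n. norm (x - (y n + z n) /\<^sub>R 2) < inverse (real (Suc n))" "\<And>n. \<not> norm (y n - z n) < \<epsilon>"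
    by metis
  have "(\<lambda>n. norm (x - (y n + z n) /\<^sub>R 2)) \<longlonglongrightarrow> 0"
    by (rule tendsto_sandwich[OF _ _ tendsto_const LIMSEQ_inverse_real_of_nat])
      (intro always_eventually allI norm_ge_zero less_imp_le[OF yz(3)])+
  then have "(\<lambda>n. norm (y n - z n)) \<longlonglongrightarrow> 0"
    using assms(1) yz(1,2) unfolding strongly_extreme_point_def by simp
  then have "eventually (\<lambda>n. norm (y n - z n) < \<epsilon>) sequentially"
    using assms(2) by (rule order_tendstoD)
  then show False using yz(4) by (auto simp: eventually_sequentially)
qed

text \<open>The points on segments from \<open>A\<close> to \<open>B\<close> already form a convex set: in a combination of two of them,
  the parts in \<open>A\<close> and the parts in \<open>B\<close> can be collected separately.\<close>

lemma in_convex_hull_Un: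
  assumes "convex A" "convex B" "A \<noteq> {}" "B \<noteq> {}" "c \<in> convex hull (A \<union> B)"
  shows "\<exists>a\<in>A. \<exists>b\<in>B. c \<in> closed_segment a b"
proof -
  define E where "E = {c. \<exists>a\<in>A. \<exists>b\<in>B. \<exists>u\<ge>0. \<exists>v\<ge>0. u + v = 1 \<and> c = u *\<^sub>R a + v *\<^sub>R b}"
  have "convex E"
  proof (rule convexI)
    fix c d and p q :: real
    assume "c \<in> E" "d \<in> E" and pq: "0 \<le> p" "0 \<le> q" "p + q = 1"
    then obtain a b u v a' b' u' v' where *: "a \<in> A" "b \<in> B" "u \<ge> 0" "v \<ge> 0" "u + v = 1"
        "c = u *\<^sub>R a + v *\<^sub>R b" "a' \<in> A" "b' \<in> B" "u' \<ge> 0" "v' \<ge> 0" "u' + v' = 1"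
        "d = u' *\<^sub>R a' + v' *\<^sub>R b'"
      unfolding E_def by blast
    obtain a'' where a'': "a'' \<in> A" "(p * u) *\<^sub>R a + (q * u') *\<^sub>R a' = (p * u + q * u') *\<^sub>R a''"
      using convex_cone_add[OF assms(1), of a a' "p * u" "q * u'"] * pq by auto
    obtain b'' where b'': "b'' \<in> B" "(p * v) *\<^sub>R b + (q * v') *\<^sub>R b' = (p * v + q * v') *\<^sub>R b''"
      using convex_cone_add[OF assms(2), of b b' "p * v" "q * v'"] * pq by auto
    have "(p * u + q * u') + (p * v + q * v') = p * (u + v) + q * (u' + v')"
      by (simp add: algebra_simps)
    then have "(p * u + q * u') + (p * v + q * v') = 1" using * pq by simp
    moreover have "p *\<^sub>R c + q *\<^sub>R d = (p * u + q * u') *\<^sub>R a'' + (p * v + q * v') *\<^sub>R b''"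
      unfolding a''(2)[symmetric] b''(2)[symmetric] *(6) *(12) by (simp add: algebra_simps)
    ultimately show "p *\<^sub>R c + q *\<^sub>R d \<in> E"
      unfolding E_def using a''(1) b''(1) * pq
      by (intro CollectI bexI[of _ a''] bexI[of _ b''] exI[of _ "p * u + q * u'"]
          exI[of _ "p * v + q * v'"] conjI) auto
  qed
  moreover have "A \<union> B \<subseteq> E"
  proof -
    obtain a b where "a \<in> A" "b \<in> B" using assms by blast
    have "c \<in> E" if "c \<in> A" for c
      unfolding E_def using that \<open>b \<in> B\<close>
      by (intro CollectI bexI[of _ c] bexI[of _ b] exI[of _ "1::real"] exI[of _ "0::real"] conjI) auto
    moreover have "c \<in> E" if "c \<in> B" for c
      unfolding E_def using that \<open>a \<in> A\<close>
      by (intro CollectI bexI[of _ a] bexI[of _ c] exI[of _ "0::real"] exI[of _ "1::real"] conjI) auto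
    ultimately show ?thesis by blast
  qed
  ultimately have "convex hull (A \<union> B) \<subseteq> E" by (rule hull_minimal[rotated])
  with assms obtain a b u v where "a \<in> A" "b \<in> B" "u \<ge> 0" "v \<ge> 0" "u + v = 1" "c = u *\<^sub>R a + v *\<^sub>R b"
    unfolding E_def by blast
  then show ?thesis
    by (intro bexI[of _ a] bexI[of _ b]) (auto simp: closed_segment_def intro!: exI[of _ v])
qed

text \<open>If \<open>c\<close> is on the segment from \<open>a\<close> to \<open>b\<close> and no further from \<open>a\<close> than from \<open>b\<close>, the reflection of
  \<open>a\<close> in \<open>c\<close> is still on the segment, hence in the ball. So \<open>c\<close> is the midpoint of \<open>a\<close> and another point of
  the ball, and \<open>a\<close> is close to \<open>c\<close> when \<open>c\<close> is close to \<open>x\<close>.\<close>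

lemma strongly_extreme_near_segment_end:
  assumes x: "strongly_extreme_point x" and "\<rho> > 0"
  obtains r where "r > 0"
    "\<And>a b c. norm a \<le> 1 \<Longrightarrow> norm b \<le> 1 \<Longrightarrow> c \<in> closed_segment a b \<Longrightarrow> norm (c - x) < r \<Longrightarrow>
       norm (a - x) < \<rho> \<or> norm (b - x) < \<rho>"
proof -
  obtain \<delta> where \<delta>: "\<delta> > 0" and mod: "\<And>y z. norm y \<le> 1 \<Longrightarrow> norm z \<le> 1 \<Longrightarrow>
      norm (x - (y + z) /\<^sub>R 2) < \<delta> \<Longrightarrow> norm (y - z) < \<rho>"
    using strongly_extreme_modulus[OF x, of \<rho>] \<open>\<rho> > 0\<close> by blast
  define r where "r = min \<delta> (\<rho> / 2)"
  have half: "norm (a - x) < \<rho>"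
    if "norm a \<le> 1" "norm b \<le> 1" "0 \<le> t" "t \<le> 1/2" "c = (1 - t) *\<^sub>R a + t *\<^sub>R b" "norm (c - x) < r"
    for a b c t
  proof -
    \<comment> \<open>the reflection \<open>2 c - a\<close>\<close>
    define z where "z = (1 - 2 * t) *\<^sub>R a + (2 * t) *\<^sub>R b"
    have "z \<in> cball 0 1" unfolding z_def using that by (intro convexD[OF convex_cball]) auto
    moreover have ac: "(a + z) /\<^sub>R 2 = c"
    proof -
      have "a + z = 2 *\<^sub>R c" unfolding z_def that(5) by (simp add: algebra_simps scaleR_2)
      then show ?thesis by simp
    qed
    moreover have "norm (x - c) < \<delta>" using that(6) by (simp add: r_def norm_minus_commute)
    ultimately have "norm (a - z) < \<rho>" using mod[of a z] that(1) by simp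
    moreover have "a - c = (1/2) *\<^sub>R (a - z)" unfolding ac[symmetric]
      by (simp add: algebra_simps) (metis (no_types) scaleR_2 scaleR_left.add field_sum_of_halves scaleR_one)
    ultimately have "norm (a - c) < \<rho> / 2" by simp
    moreover have "norm (c - x) < \<rho> / 2" using that(6) by (simp add: r_def)
    ultimately show ?thesis using norm_triangle_ineq[of "a - c" "c - x"] by simp
  qed
  show ?thesis
  proof (rule that)
    show "r > 0" using \<delta> \<open>\<rho> > 0\<close> by (simp add: r_def)
    fix a b c
    assume ab: "norm a \<le> 1" "norm b \<le> 1" and "c \<in> closed_segment a b" and cx: "norm (c - x) < r"
    then obtain t where t: "0 \<le> t" "t \<le> 1" "c = (1 - t) *\<^sub>R a + t *\<^sub>R b"
      by (auto simp: closed_segment_def)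
    show "norm (a - x) < \<rho> \<or> norm (b - x) < \<rho>"
    proof (cases "t \<le> 1/2")
      case True
      then show ?thesis using half[OF ab t(1) _ t(3) cx] by simp
    next
      case False
      then show ?thesis using half[OF ab(2,1), of "1 - t" c] t cx by (simp add: add.commute)
    qed
  qed
qed

text \<open>For a strongly extreme point, being away from a convex set survives convex hulls of finite unions.
  Adding one set at a time leaves only segments between two convex sets to consider.\<close>

lemma strongly_extreme_away_Union:
  assumes x: "strongly_extreme_point x" and "finite \<C>"
    and "\<And>C. C \<in> \<C> \<Longrightarrow> convex C \<and> C \<subseteq> cball 0 1 \<and> (\<exists>r>0. \<forall>c\<in>C. r \<le> norm (c - x))"
  shows "\<exists>r>0. \<forall>c\<in>convex hull \<Union>\<C>. r \<le> norm (c - x)"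
  using assms(2,3)
proof (induction \<C>)
  case empty
  then show ?case by (auto intro: exI[of _ 1])
next
  case (insert C \<C>)
  define H where "H = convex hull \<Union>\<C>"
  obtain r1 where r1: "r1 > 0" "\<forall>c\<in>C. r1 \<le> norm (c - x)" using insert.prems by blast
  obtain r2 where r2: "r2 > 0" "\<forall>c\<in>H. r2 \<le> norm (c - x)"
    using insert.IH insert.prems unfolding H_def by blast
  have C: "convex C" "C \<subseteq> cball 0 1" using insert.prems by auto
  have "\<Union>\<C> \<subseteq> cball 0 1" using insert.prems by (intro Union_least) simp
  then have H: "convex H" "H \<subseteq> cball 0 1"
    unfolding H_def by (simp_all add: hull_minimal)
  have eq: "convex hull \<Union>(insert C \<C>) = convex hull (C \<union> H)"
    unfolding H_def by (simp add: hull_Un_right[symmetric])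
  show ?case
  proof (cases "C = {} \<or> H = {}")
    case True
    then show ?thesis
      using r1 r2 C H unfolding eq by (auto simp: convex_hull_eq[THEN iffD2] hull_same)
  next
    case False
    obtain r where r: "r > 0" "\<And>a b c. norm a \<le> 1 \<Longrightarrow> norm b \<le> 1 \<Longrightarrow> c \<in> closed_segment a b \<Longrightarrow>
        norm (c - x) < r \<Longrightarrow> norm (a - x) < min r1 r2 \<or> norm (b - x) < min r1 r2"
      using strongly_extreme_near_segment_end[OF x, of "min r1 r2"] r1(1) r2(1) by auto
    have "r \<le> norm (c - x)" if c: "c \<in> convex hull (C \<union> H)" for c
    proof (rule ccontr)
      assume "\<not> r \<le> norm (c - x)"
      moreover obtain a b where ab: "a \<in> C" "b \<in> H" "c \<in> closed_segment a b"
        using in_convex_hull_Un[OF C(1) H(1) _ _ c] False by blast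
      ultimately have "norm (a - x) < min r1 r2 \<or> norm (b - x) < min r1 r2"
        using C(2) H(2) by (intro r(2)[of a b c]) auto
      then show False using r1(2) r2(2) ab by force
    qed
    then show ?thesis using r(1) unfolding eq by blast
  qed
qed

lemma compact_operator_bounded_linear:
  assumes "compact_operator T"
  shows "bounded_linear T"
proof -
  have lin: "linear T" and "bounded (T ` cball 0 1)"
    using assms unfolding compact_operator_def
    by (auto intro: bounded_subset[OF compact_imp_bounded closure_subset])
  then obtain B where B: "\<And>y. norm y \<le> 1 \<Longrightarrow> norm (T y) \<le> B"
    by (metis bounded_iff imageI mem_cball_0)
  show ?thesis
  proof (intro bounded_linear.intro lin bounded_linear_axioms.intro exI allI)
    fix y
    show "norm (T y) \<le> norm y * B"
    proof (cases "y = 0")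
      case True
      then show ?thesis using linear_0[OF lin] by simp
    next
      case False
      then have "norm (T (y /\<^sub>R norm y)) \<le> B" by (intro B) simp
      then show ?thesis using False by (simp add: linear_cmul[OF lin] field_simps)
    qed
  qed
qed

text \<open>The image of the ball under \<open>T\<close> is covered by finitely many balls of radius \<open>\<eta> / 4\<close>. Their
  preimages are convex. Such a preimage that meets \<open>D\<close> has an image of diameter at most \<open>\<eta> / 2\<close>, so
  this image keeps distance \<open>\<eta> / 2\<close> from \<open>T x\<close>, and by continuity of \<open>T\<close> the preimage keeps a
  positive distance from \<open>x\<close>.\<close>

lemma strongly_extreme_away_compact:
  assumes x: "strongly_extreme_point x" and T: "compact_operator T" and "\<eta> > 0"
    and D: "D \<subseteq> cball 0 1" "\<And>d. d \<in> D \<Longrightarrow> \<eta> \<le> norm (T d - T x)"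
  shows "\<exists>r>0. \<forall>c\<in>convex hull D. r \<le> norm (c - x)"
proof -
  have bl: "bounded_linear T" using T by (rule compact_operator_bounded_linear)
  then have lin: "linear T" by (rule bounded_linear.linear)
  obtain B where B: "B > 0" "\<And>y. norm (T y) \<le> norm y * B"
    using bounded_linear.pos_bounded[OF bl] by blast
  obtain Z where Z: "finite Z" "closure (T ` cball 0 1) \<subseteq> (\<Union>z\<in>Z. ball z (\<eta> / 4))"
    using T \<open>\<eta> > 0\<close> unfolding compact_operator_def compact_eq_totally_bounded
    by (meson divide_pos_pos zero_less_numeral)
  define cell where "cell z = cball 0 1 \<inter> T -` cball z (\<eta> / 4)" for z
  define \<C> where "\<C> = cell ` {z \<in> Z. cell z \<inter> D \<noteq> {}}"
  have "\<exists>r>0. \<forall>c\<in>convex hull \<Union>\<C>. r \<le> norm (c - x)"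
  proof (rule strongly_extreme_away_Union[OF x])
    show "finite \<C>" using Z(1) by (simp add: \<C>_def)
    fix C assume "C \<in> \<C>"
    then obtain z d where z: "C = cell z" "d \<in> cell z" "d \<in> D" by (auto simp: \<C>_def)
    have "convex C" unfolding z cell_def
      by (intro convex_Int convex_cball convex_linear_vimage lin)
    moreover have "\<eta> / (2 * B) \<le> norm (c - x)" if "c \<in> C" for c
    proof -
      have "norm (T d - T c) \<le> dist z (T d) + dist z (T c)"
        by (metis dist_norm dist_triangle3 dist_commute)
      also have "\<dots> \<le> \<eta> / 2" using z that by (auto simp: cell_def)
      finally have "norm (T d - T c) \<le> \<eta> / 2" .
      then have "\<eta> / 2 \<le> norm (T c - T x)"
        using D(2)[OF z(3)] norm_triangle_ineq[of "T d - T c" "T c - T x"] by simp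
      also have "\<dots> \<le> norm (c - x) * B" using B(2)[of "c - x"] by (simp add: linear_diff[OF lin])
      finally show ?thesis using B(1) by (simp add: field_simps)
    qed
    ultimately show "convex C \<and> C \<subseteq> cball 0 1 \<and> (\<exists>r>0. \<forall>c\<in>C. r \<le> norm (c - x))"
      using B(1) \<open>\<eta> > 0\<close> z(1) by (auto simp: cell_def intro!: exI[of _ "\<eta> / (2 * B)"])
  qed
  moreover have "D \<subseteq> \<Union>\<C>"
  proof
    fix d assume d: "d \<in> D"
    then have "T d \<in> closure (T ` cball 0 1)" using D(1) closure_subset by blast
    then obtain z where "z \<in> Z" "T d \<in> ball z (\<eta> / 4)" using Z(2) by blast
    then show "d \<in> \<Union>\<C>" using d D(1) by (force simp: \<C>_def cell_def intro: less_imp_le)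
  qed
  ultimately show ?thesis using hull_mono by (metis subsetD)
qed

section \<open>The unconditional compact approximation property\<close>

text \<open>The point \<open>w = 2 T y - y\<close> reflects \<open>y\<close> in \<open>T y\<close>. It may leave the ball by \<open>s\<close>, and rescaling by
  \<open>1 + s\<close> moves it by at most \<open>s\<close>. Then \<open>x\<close> is nearly the midpoint of \<open>y\<close> and the rescaled point, so
  these are close, and hence \<open>y\<close> is close to \<open>T y\<close> and to \<open>x\<close>. The numbers \<open>\<eta>\<close> and \<open>s\<close> do not
  depend on \<open>T\<close>, so that an operator of an approximating sequence can be chosen to suit them.\<close>

lemma strongly_extreme_localized:
  fixes x :: "'a::real_normed_vector"
  assumes x: "strongly_extreme_point x" and "\<epsilon> > 0"
  obtains \<eta> s where "\<eta> > 0" "s > 0"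
    "\<And>T y. norm y \<le> 1 \<Longrightarrow> norm (y - 2 *\<^sub>R T y) \<le> 1 + s \<Longrightarrow> norm (T y - x) < \<eta> \<Longrightarrow> norm (y - x) < \<epsilon>"
proof -
  obtain \<delta> where \<delta>: "\<delta> > 0" and mod: "\<And>y z. norm y \<le> 1 \<Longrightarrow> norm z \<le> 1 \<Longrightarrow>
      norm (x - (y + z) /\<^sub>R 2) < \<delta> \<Longrightarrow> norm (y - z) < \<epsilon>"
    using strongly_extreme_modulus[OF x \<open>\<epsilon> > 0\<close>] by blast
  \<comment> \<open>chosen so that \<open>\<eta> + s / 2 < \<delta>\<close> and \<open>\<epsilon> + s + 2 \<eta> \<le> 2 \<epsilon>\<close>\<close>
  define \<eta> where "\<eta> = min (\<delta> / 2) (\<epsilon> / 4)"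
  define s where "s = min (\<delta> / 2) (\<epsilon> / 2)"
  have s: "s > 0" using \<delta> \<open>\<epsilon> > 0\<close> by (simp add: s_def)
  show ?thesis
  proof (rule that[OF _ s])
    show "\<eta> > 0" using \<delta> \<open>\<epsilon> > 0\<close> by (simp add: \<eta>_def)
    fix T :: "'a \<Rightarrow> 'a" and y
    assume y: "norm y \<le> 1" and Ty: "norm (y - 2 *\<^sub>R T y) \<le> 1 + s" "norm (T y - x) < \<eta>"
    define w where "w = 2 *\<^sub>R T y - y"
    define z where "z = w /\<^sub>R (1 + s)"
    have w: "norm w \<le> 1 + s" using Ty(1) by (simp add: w_def norm_minus_commute)
    have z: "norm z \<le> 1" using w s by (simp add: z_def field_simps)
    have "z - w = - (s *\<^sub>R z)"
    proof -
      have "w = (1 + s) *\<^sub>R z" using s by (simp add: z_def)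
      then show ?thesis by (simp add: algebra_simps)
    qed
    then have "norm (z - w) = s * norm z" using s by simp
    also have "\<dots> \<le> s * 1" using z s by (intro mult_left_mono) auto
    finally have zw: "norm (z - w) \<le> s" by simp
    have "x - (y + z) /\<^sub>R 2 = (x - T y) - (1/2) *\<^sub>R (z - w)"
      by (simp add: w_def algebra_simps)
    then have "norm (x - (y + z) /\<^sub>R 2) \<le> norm (x - T y) + norm ((1/2) *\<^sub>R (z - w))"
      using norm_triangle_ineq4 by metis
    also have "\<dots> = norm (T y - x) + norm (z - w) / 2" by (simp add: norm_minus_commute)
    also have "\<dots> < \<delta>" using Ty(2) zw \<delta> by (simp add: \<eta>_def s_def)
    finally have "norm (y - z) < \<epsilon>" by (rule mod[OF y z])
    moreover have "2 *\<^sub>R (y - x) = (y - z) + (z - w) + 2 *\<^sub>R (T y - x)"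
      by (simp add: w_def algebra_simps scaleR_2)
    then have "norm (2 *\<^sub>R (y - x)) \<le> norm (y - z) + norm (z - w) + norm (2 *\<^sub>R (T y - x))"
      by (metis (no_types, lifting) norm_triangle_ineq norm_triangle_le add_mono order_refl)
    then have "2 * norm (y - x) \<le> norm (y - z) + norm (z - w) + 2 * norm (T y - x)" by simp
    ultimately show "norm (y - x) < \<epsilon>" using zw Ty(2) by (simp add: \<eta>_def s_def)
  qed
qed

text \<open>A functional \<open>g\<close> that separates \<open>x\<close> from the points at distance at least \<open>\<rho>\<close> yields the slice
  \<open>{y. g y > g x - r}\<close>, which lies within \<open>\<rho>\<close> of \<open>x\<close>. The definition of a denting point
  prescribes \<open>\<delta>\<close>, so \<open>g\<close> is rescaled until \<open>\<delta>\<close> cuts off exactly this slice. In a nontrivial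
  space the ball contains a point at distance at least \<open>1\<close> from \<open>x\<close>; with \<open>\<rho> \<le> 1\<close> this shows that \<open>g\<close> does not vanish.\<close>

lemma denting_pointI:
  fixes x :: "'a::real_normed_vector"
  assumes x: "norm x \<le> 1" and nontriv: "\<exists>v::'a. v \<noteq> 0"
    and away: "\<And>\<epsilon>. \<epsilon> > 0 \<Longrightarrow>
      \<exists>r>0. \<forall>c\<in>convex hull {y \<in> cball 0 1. \<epsilon> \<le> norm (y - x)}. r \<le> norm (c - x)"
  shows "denting_point x"
  unfolding denting_point_def
proof (intro conjI allI impI)
  show "x \<in> cball 0 1" using x by simp
  fix \<epsilon> \<delta> :: real assume "\<epsilon> > 0" "\<delta> > 0"
  define \<rho> where "\<rho> = min 1 (\<epsilon> / 4)"
  define D where "D = {y \<in> cball 0 1. \<rho> \<le> norm (y - x)}"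
  have \<rho>: "\<rho> > 0" using \<open>\<epsilon> > 0\<close> by (simp add: \<rho>_def)
  obtain r where r: "r > 0" "\<And>c. c \<in> convex hull D \<Longrightarrow> r \<le> norm (c - x)"
    using away[OF \<rho>] unfolding D_def by blast
  have "convex ((\<lambda>c. x - c) ` (convex hull D))"
    using convex_linear_image[of uminus "convex hull D"] convex_translation[of "uminus ` (convex hull D)" x]
    by (simp add: image_image linear_uminus)
  moreover have "r \<le> norm a" if "a \<in> (\<lambda>c. x - c) ` (convex hull D)" for a
    using that r(2) by (auto simp: norm_minus_commute)
  ultimately obtain g :: "'a \<Rightarrow>\<^sub>L real" where g: "\<And>c. c \<in> convex hull D \<Longrightarrow> r \<le> g (x - c)"
    using separating_functional[of "(\<lambda>c. x - c) ` (convex hull D)" r] by auto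
  have D: "g c \<le> g x - r" if "c \<in> D" for c
    using g[OF hull_inc[OF that]] by (simp add: blinfun.diff_right)
  have "D \<noteq> {}"
  proof (cases "x = 0")
    case True
    obtain v :: 'a where "v \<noteq> 0" using nontriv by blast
    then have "v /\<^sub>R norm v \<in> D" using True by (simp add: D_def \<rho>_def)
    then show ?thesis by blast
  next
    case False
    have "- (x /\<^sub>R norm x) - x = - ((1 + inverse (norm x)) *\<^sub>R x)" by (simp add: algebra_simps)
    then have "norm (- (x /\<^sub>R norm x) - x) = (1 + inverse (norm x)) * norm x"
      by (simp only: norm_minus_cancel norm_scaleR) simp
    also have "\<dots> = norm x + 1" using False by (simp add: field_simps)
    also have "\<dots> \<ge> \<rho>" by (simp add: \<rho>_def min_le_iff_disj)
    finally have "- (x /\<^sub>R norm x) \<in> D" using False by (simp add: D_def)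
    then show ?thesis by blast
  qed
  then have "g \<noteq> 0" using D r(1) by force
  define S where "S = (SUP z\<in>cball 0 1. g z)"
  have bdd: "bdd_above (blinfun_apply g ` cball 0 1)"
  proof (rule bdd_aboveI2)
    fix z :: 'a assume "z \<in> cball 0 1"
    then have "norm g * norm z \<le> norm g * 1" by (intro mult_left_mono) auto
    then show "g z \<le> norm g" using norm_blinfun[of g z] by simp
  qed
  have gS: "g x \<le> S" unfolding S_def using x by (intro cSUP_upper bdd) simp
  define t where "t = \<delta> / (S - g x + r)"
  have den: "S - g x + r > 0" using gS r(1) by simp
  then have t: "t > 0" using \<open>\<delta> > 0\<close> by (simp add: t_def)
  have "(SUP z\<in>cball 0 1. (t *\<^sub>R g) z) = t * S"
  proof (rule antisym)
    show "(SUP z\<in>cball 0 1. (t *\<^sub>R g) z) \<le> t * S"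
      unfolding S_def using t
      by (intro cSUP_least) (auto simp: blinfun.scaleR_left intro!: mult_left_mono cSUP_upper bdd)
    have bdd': "bdd_above (blinfun_apply (t *\<^sub>R g) ` cball 0 1)"
    proof (rule bdd_aboveI2)
      fix z :: 'a assume "z \<in> cball 0 1"
      then show "(t *\<^sub>R g) z \<le> t * S"
        unfolding S_def using t
        by (auto simp: blinfun.scaleR_left intro!: mult_left_mono cSUP_upper bdd)
    qed
    have "S \<le> (SUP z\<in>cball 0 1. (t *\<^sub>R g) z) / t"
      unfolding S_def
    proof (rule cSUP_least)
      fix z :: 'a assume "z \<in> cball 0 1"
      then have "(t *\<^sub>R g) z \<le> (SUP z\<in>cball 0 1. (t *\<^sub>R g) z)" by (intro cSUP_upper bdd')
      then show "g z \<le> (SUP z\<in>cball 0 1. (t *\<^sub>R g) z) / t"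
        using t by (simp add: field_simps blinfun.scaleR_left)
    qed simp
    then show "t * S \<le> (SUP z\<in>cball 0 1. (t *\<^sub>R g) z)" using t by (simp add: field_simps)
  qed
  moreover have "t * S - \<delta> = t * (g x - r)"
    using den by (simp add: t_def field_simps)
  ultimately have slice: "ball_slice (t *\<^sub>R g) \<delta> = {y \<in> cball 0 1. g y > g x - r}"
    using t by (simp add: ball_slice_def blinfun.scaleR_left)
  have near: "norm (y - x) < \<rho>" if "y \<in> ball_slice (t *\<^sub>R g) \<delta>" for y
  proof (rule ccontr)
    assume "\<not> norm (y - x) < \<rho>"
    then have "y \<in> D" using that by (auto simp: slice D_def)
    then show False using D that by (force simp: slice)
  qed
  have "diameter (ball_slice (t *\<^sub>R g) \<delta>) \<le> 2 * \<rho>"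
  proof (rule diameter_le)
    fix y z assume "y \<in> ball_slice (t *\<^sub>R g) \<delta>" "z \<in> ball_slice (t *\<^sub>R g) \<delta>"
    then show "norm (y - z) \<le> 2 * \<rho>"
      using near[of y] near[of z] norm_triangle_ineq4[of "y - x" "z - x"] by simp
  qed (use \<rho> in simp)
  also have "\<dots> < \<epsilon>" using \<open>\<epsilon> > 0\<close> by (simp add: \<rho>_def)
  finally have "diameter (ball_slice (t *\<^sub>R g) \<delta>) < \<epsilon>" .
  moreover have "x \<in> ball_slice (t *\<^sub>R g) \<delta>" using x r(1) by (simp add: slice)
  ultimately show "\<exists>f. f \<noteq> 0 \<and> x \<in> ball_slice f \<delta> \<and> diameter (ball_slice f \<delta>) < \<epsilon>"
    using \<open>g \<noteq> 0\<close> t by (intro exI[of _ "t *\<^sub>R g"]) auto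
qed

theorem UKAP_strongly_extreme_imp_denting:
  fixes x :: "'a::banach"
  assumes "UKAP TYPE('a)" and x: "strongly_extreme_point x"
  shows "denting_point x"
proof -
  obtain T :: "nat \<Rightarrow> 'a \<Rightarrow> 'a" where T: "\<And>n. compact_operator (T n)"
      "\<And>x. (\<lambda>n. norm (T n x - x)) \<longlonglongrightarrow> 0" "(\<lambda>n. onorm (\<lambda>x. x - 2 *\<^sub>R T n x)) \<longlonglongrightarrow> 1"
    using assms(1) unfolding UKAP_def by blast
  have bl: "bounded_linear (\<lambda>x. x - 2 *\<^sub>R T n x)" for n
    by (intro bounded_linear_sub bounded_linear_ident bounded_linear_const_scaleR
        compact_operator_bounded_linear T)
  show ?thesis
  proof (rule denting_pointI)
    show "norm x \<le> 1" using x by (simp add: strongly_extreme_point_def)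
    \<comment> \<open>on the trivial space all operator norms are \<open>0\<close> and cannot tend to \<open>1\<close>\<close>
    show "\<exists>v::'a. v \<noteq> 0"
    proof (rule ccontr)
      assume "\<not> (\<exists>v::'a. v \<noteq> 0)"
      then have "onorm (\<lambda>x. x - 2 *\<^sub>R T n x) = 0" for n
        using onorm_eq_0[OF bl] by metis
      then show False using T(3) LIMSEQ_unique[OF tendsto_const] by force
    qed
    fix \<epsilon> :: real assume "\<epsilon> > 0"
    obtain \<eta> s where \<eta>s: "\<eta> > 0" "s > 0" and local: "\<And>T y. norm y \<le> 1 \<Longrightarrow>
        norm (y - 2 *\<^sub>R T y) \<le> 1 + s \<Longrightarrow> norm (T y - x) < \<eta> \<Longrightarrow> norm (y - x) < \<epsilon>"
      using strongly_extreme_localized[OF x \<open>\<epsilon> > 0\<close>] by metis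
    have "eventually (\<lambda>n. norm (T n x - x) < \<eta> / 2) sequentially"
      using T(2) \<eta>s(1) by (intro order_tendstoD(2)[of _ 0]) auto
    moreover have "eventually (\<lambda>n. onorm (\<lambda>x. x - 2 *\<^sub>R T n x) < 1 + s) sequentially"
      using T(3) \<eta>s(2) by (intro order_tendstoD(2)[of _ 1]) auto
    ultimately have "eventually (\<lambda>n. norm (T n x - x) < \<eta> / 2 \<and>
        onorm (\<lambda>x. x - 2 *\<^sub>R T n x) < 1 + s) sequentially"
      by (rule eventually_conj)
    then obtain n where n: "norm (T n x - x) < \<eta> / 2" "onorm (\<lambda>x. x - 2 *\<^sub>R T n x) < 1 + s"
      by (auto simp: eventually_sequentially)
    show "\<exists>r>0. \<forall>c\<in>convex hull {y \<in> cball 0 1. \<epsilon> \<le> norm (y - x)}. r \<le> norm (c - x)"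
    proof (rule strongly_extreme_away_compact[OF x T(1)])
      show "\<eta> / 2 > 0" using \<eta>s by simp
      fix d assume "d \<in> {y \<in> cball 0 1. \<epsilon> \<le> norm (y - x)}"
      then have d: "norm d \<le> 1" "\<epsilon> \<le> norm (d - x)" by auto
      have "norm (d - 2 *\<^sub>R T n d) \<le> onorm (\<lambda>x. x - 2 *\<^sub>R T n x) * norm d" by (rule onorm[OF bl])
      also have "\<dots> \<le> (1 + s) * 1"
        using n(2) d(1) \<eta>s by (intro mult_mono) auto
      finally have "\<not> norm (T n d - x) < \<eta>" using local[of d "T n"] d by auto
      then show "\<eta> / 2 \<le> norm (T n d - T n x)"
        using n(1) norm_triangle_ineq[of "T n d - T n x" "T n x - x"] by simp
    qed auto
  qed
qed

section \<open>Unconditional bases with constant one\<close>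

lemma basis_expansion_coeff:
  assumes "schauder_basis N e"
  shows "basis_expansion N e (basis_coeff N e x) x"
  unfolding basis_coeff_def using assms unfolding schauder_basis_def by (metis theI')

lemma basis_coeff_unique:
  assumes "schauder_basis N e" "basis_expansion N e a x"
  shows "basis_coeff N e x = a"
  using basis_expansion_coeff[OF assms(1), of x] assms unfolding schauder_basis_def by blast

lemma linear_basis_coeff:
  assumes "schauder_basis N e"
  shows "linear (\<lambda>x. basis_coeff N e x k)"
proof (rule linearI)
  note exp = basis_expansion_coeff[OF assms]
  fix x y
  have "basis_expansion N e (\<lambda>k. basis_coeff N e x k + basis_coeff N e y k) (x + y)"
    using exp[of x] exp[of y] by (auto simp: basis_expansion_def scaleR_left_distrib intro: sums_add)
  from basis_coeff_unique[OF assms this]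
  show "basis_coeff N e (x + y) k = basis_coeff N e x k + basis_coeff N e y k" by simp
next
  note exp = basis_expansion_coeff[OF assms]
  fix c :: real and x
  have "(\<lambda>k. c *\<^sub>R (basis_coeff N e x k *\<^sub>R e k)) sums (c *\<^sub>R x)"
    using exp[of x] by (intro sums_scaleR_right) (simp add: basis_expansion_def)
  then have "basis_expansion N e (\<lambda>k. c * basis_coeff N e x k) (c *\<^sub>R x)"
    using exp[of x] by (auto simp: basis_expansion_def)
  from basis_coeff_unique[OF assms this]
  show "basis_coeff N e (c *\<^sub>R x) k = c *\<^sub>R basis_coeff N e x k" by simp
qed

definition basis_projection :: "enat \<Rightarrow> (nat \<Rightarrow> 'a::banach) \<Rightarrow> nat \<Rightarrow> 'a \<Rightarrow> 'a" where
  "basis_projection N e n x = (\<Sum>k<n. basis_coeff N e x k *\<^sub>R e k)"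

lemma linear_basis_projection:
  assumes "schauder_basis N e"
  shows "linear (basis_projection N e n)"
  unfolding basis_projection_def
  by (intro linear_compose_sum ballI linear_compose[OF linear_basis_coeff[OF assms], unfolded o_def]
      linear_scaleR_left)

lemma sign_operator_initial_flip:
  assumes "schauder_basis N e"
  shows "sign_operator N e (\<lambda>k. if k < n then - 1 else 1) x = x - 2 *\<^sub>R basis_projection N e n x"
proof -
  let ?c = "basis_coeff N e x"
  have "(\<lambda>k. ?c k *\<^sub>R e k) sums x"
    using basis_expansion_coeff[OF assms, of x] by (simp add: basis_expansion_def)
  then have "(\<lambda>k. ?c k *\<^sub>R e k + (if k \<in> {..<n} then (-2) *\<^sub>R (?c k *\<^sub>R e k) else 0))
      sums (x + (\<Sum>k<n. (-2) *\<^sub>R (?c k *\<^sub>R e k)))"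
    by (intro sums_add sums_If_finite_set) auto
  moreover have "(\<lambda>k. ?c k *\<^sub>R e k + (if k \<in> {..<n} then (-2) *\<^sub>R (?c k *\<^sub>R e k) else 0)) =
      (\<lambda>k. ((if k < n then - 1 else 1) * ?c k) *\<^sub>R e k)"
    by (auto simp: fun_eq_iff scaleR_2 simp flip: scaleR_scaleR)
  moreover have "(\<Sum>k<n. (-2) *\<^sub>R (?c k *\<^sub>R e k)) = - (2 *\<^sub>R basis_projection N e n x)"
    unfolding basis_projection_def scaleR_sum_right sum_negf[symmetric] by simp
  ultimately show ?thesis unfolding sign_operator_def by (simp add: sums_iff)
qed

lemma compact_scaled_vectors: "compact ((\<lambda>t. t *\<^sub>R v) ` {a..b::real})"
  for v :: "'a::real_normed_vector"
  by (intro compact_continuous_image continuous_intros) auto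

text \<open>The bound on the projections bounds each term \<open>P (Suc k) x - P k x\<close> of the expansion, so the image
  of the ball lies in a finite sum of segments.\<close>

lemma compact_operator_basis_projection:
  assumes basis: "schauder_basis N e"
    and bound: "\<And>n x. norm (basis_projection N e n x) \<le> norm x"
  shows "compact_operator (basis_projection N e n)"
proof -
  have coeff: "norm (basis_coeff N e x k *\<^sub>R e k) \<le> 2 * norm x" for x k
  proof -
    have "basis_coeff N e x k *\<^sub>R e k = basis_projection N e (Suc k) x - basis_projection N e k x"
      by (simp add: basis_projection_def)
    then show ?thesis
      using norm_triangle_ineq4[of "basis_projection N e (Suc k) x" "basis_projection N e k x"]
        bound[of "Suc k" x] bound[of k x] by simp
  qed
  have "\<exists>K. compact K \<and> basis_projection N e n ` cball 0 1 \<subseteq> K"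
  proof (induction n)
    case 0
    show ?case by (intro exI[of _ "{0}"]) (auto simp: basis_projection_def)
  next
    case (Suc n)
    then obtain K where K: "compact K" "basis_projection N e n ` cball 0 1 \<subseteq> K" by blast
    define L where "L = (\<lambda>t. t *\<^sub>R e n) ` {- (2 / norm (e n)) .. 2 / norm (e n)}"
    have "basis_coeff N e x n *\<^sub>R e n \<in> L" if "norm x \<le> 1" for x
    proof (cases "e n = 0")
      case True
      then show ?thesis by (auto simp: L_def)
    next
      case False
      have "\<bar>basis_coeff N e x n\<bar> * norm (e n) \<le> 2" using coeff[of x n] that by simp
      then have "\<bar>basis_coeff N e x n\<bar> \<le> 2 / norm (e n)" using False by (simp add: field_simps)
      then show ?thesis by (auto simp: L_def abs_le_iff)
    qed
    then have "basis_projection N e (Suc n) ` cball 0 1 \<subseteq> {u + v |u v. u \<in> K \<and> v \<in> L}"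
      using K(2) by (fastforce simp: basis_projection_def)
    moreover have "compact {u + v |u v. u \<in> K \<and> v \<in> L}"
      unfolding L_def by (intro compact_sums K compact_scaled_vectors)
    ultimately show ?case by blast
  qed
  then obtain K where "compact K" "basis_projection N e n ` cball 0 1 \<subseteq> K" by blast
  then have "compact (closure (basis_projection N e n ` cball 0 1))"
    by (metis closed_closure closure_minimal compact_Int_closed compact_imp_closed inf.absorb_iff2)
  then show ?thesis using linear_basis_projection[OF basis] by (simp add: compact_operator_def)
qed

text \<open>The bound \<open>\<parallel>I - 2 P\<^sub>n\<parallel> \<le> 1\<close> also gives \<open>\<parallel>P\<^sub>n\<parallel> \<le> 1\<close>, since \<open>2 P\<^sub>n = I - (I - 2 P\<^sub>n)\<close>. For the limit
  to be exactly \<open>1\<close> a nonzero vector is needed; it exists because on the trivial space the basis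
  constant is \<open>0\<close>.\<close>

lemma UKAP_of_unconditional_basis:
  fixes e :: "nat \<Rightarrow> 'a::banach"
  assumes "unconditional_basis N e" and const: "unconditional_basis_constant N e = 1"
  shows "UKAP TYPE('a)"
proof -
  have basis: "schauder_basis N e" using assms(1) by (simp add: unconditional_basis_def)
  let ?P = "basis_projection N e"
  have sign_le: "norm (sign_operator N e \<theta> x) / norm x \<le> 1" if "\<forall>k. \<theta> k = 1 \<or> \<theta> k = - 1" for \<theta> x
  proof -
    have "ereal (norm (sign_operator N e \<theta> x) / norm x) \<le> unconditional_basis_constant N e"
      unfolding unconditional_basis_constant_def using that
      by (intro SUP_upper2[of \<theta>] SUP_upper2[of x]) auto
    then show ?thesis by (simp add: const)
  qed
  have flip: "norm (x - 2 *\<^sub>R ?P n x) \<le> norm x" for n x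
  proof (cases "x = 0")
    case True
    then show ?thesis using linear_0[OF linear_basis_projection[OF basis]] by simp
  next
    case False
    then show ?thesis
      using sign_le[of "\<lambda>k. if k < n then - 1 else 1" x]
      by (simp add: sign_operator_initial_flip[OF basis])
  qed
  have bound: "norm (?P n x) \<le> norm x" for n x
    using norm_triangle_ineq4[of x "x - 2 *\<^sub>R ?P n x"] flip[of x n] by simp
  have lim: "(\<lambda>n. ?P n x) \<longlonglongrightarrow> x" for x
    using basis_expansion_coeff[OF basis, of x]
    by (simp add: basis_expansion_def sums_def basis_projection_def)
  have comp: "compact_operator (?P n)" for n
    by (rule compact_operator_basis_projection[OF basis bound])
  have bl: "bounded_linear (\<lambda>x. x - 2 *\<^sub>R ?P n x)" for n
    by (intro bounded_linear_sub bounded_linear_ident bounded_linear_const_scaleR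
        compact_operator_bounded_linear comp)
  obtain v :: 'a where v: "v \<noteq> 0"
  proof (rule ccontr)
    assume "\<not> thesis"
    then have "\<And>v::'a. v = 0" using that by blast
    then have "norm (sign_operator N e \<theta> x) / norm x \<le> 0" for \<theta> x
      by (metis div_by_0 norm_zero order_refl)
    then have "unconditional_basis_constant N e \<le> 0"
      unfolding unconditional_basis_constant_def by (intro SUP_least) (simp only: ereal_less_eq)
    then show False by (simp add: const)
  qed
  have "(\<lambda>n. onorm (\<lambda>x. x - 2 *\<^sub>R ?P n x)) \<longlonglongrightarrow> 1"
  proof (rule tendsto_sandwich)
    show "\<forall>\<^sub>F n in sequentially. norm (v - 2 *\<^sub>R ?P n v) / norm v \<le> onorm (\<lambda>x. x - 2 *\<^sub>R ?P n x)"
      by (intro always_eventually allI le_onorm[OF bl])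
    show "\<forall>\<^sub>F n in sequentially. onorm (\<lambda>x. x - 2 *\<^sub>R ?P n x) \<le> 1"
      by (intro always_eventually allI onorm_bound) (simp_all add: flip)
    have "(\<lambda>n. norm (v - 2 *\<^sub>R ?P n v) / norm v) \<longlonglongrightarrow> norm (v - 2 *\<^sub>R v) / norm v"
      using v by (intro tendsto_intros lim) simp
    moreover have "norm (v - 2 *\<^sub>R v) / norm v = 1" using v by (simp add: scaleR_2)
    ultimately show "(\<lambda>n. norm (v - 2 *\<^sub>R ?P n v) / norm v) \<longlonglongrightarrow> 1" by simp
  qed simp
  moreover have "(\<lambda>n. norm (?P n x - x)) \<longlonglongrightarrow> 0" for x
    using lim[of x] by (simp add: LIM_zero tendsto_norm_zero)
  ultimately show ?thesis unfolding UKAP_def using comp by blast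
qed

theorem corollary2p9:
  shows "(UKAP TYPE('a::banach) \<longrightarrow>
            (\<forall>x::'a. strongly_extreme_point x \<longrightarrow> denting_point x)) \<and>
         ((\<exists>N (e :: nat \<Rightarrow> 'a). unconditional_basis N e \<and> unconditional_basis_constant N e = 1) \<longrightarrow>
            (\<forall>x::'a. strongly_extreme_point x \<longrightarrow> denting_point x))"
  using UKAP_strongly_extreme_imp_denting UKAP_of_unconditional_basis by blast

end
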